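(* Let $k$ be a positive integer and let $S$ be a set of positive integers with $S \supseteq \{k, 2k, 3k, 5k\}$. There is no $3$-AP-free arrangement of $S$ in which, for every pair $u, w \in S$ with $u \ge 2w$, $w$ is placed before $u$.
   Context: An arrangement of $S$ is a linear order $\prec$ of $S$ ($u \prec v$ meaning $u$ is placed before $v$). It is $3$-AP-free if for every arithmetic progression $a<b<c$ with $a,b,c \in S$, neither $a \prec b \prec c$ nor $c \prec b \prec a$ holds. *)

theory Defs
  imports Main
begin

(* r is the strict order: (u, v) \<in> r means that u is placed before v.  No finiteness of S and
   no restriction on the order type is imposed.  The inclusion in S \<times> S is explicit because
   strict_linear_order_on S r does not bound the field of r. *)
definition arrangement :: "nat set \<Rightarrow> (nat \<times> nat) set \<Rightarrow> bool" where
  "arrangement S r \<longleftrightarrow> r \<subseteq> S \<times> S \<and> strict_linear_order_on S r"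

(* The natural-number subtractions do not truncate, as a < b < c. *)
definition three_AP :: "nat \<Rightarrow> nat \<Rightarrow> nat \<Rightarrow> bool" where
  "three_AP a b c \<longleftrightarrow> a < b \<and> b < c \<and> b - a = c - b"

definition three_AP_free :: "nat set \<Rightarrow> (nat \<times> nat) set \<Rightarrow> bool" where
  "three_AP_free S r \<longleftrightarrow>
     (\<forall>a\<in>S. \<forall>b\<in>S. \<forall>c\<in>S. three_AP a b c \<longrightarrow>
        \<not> ((a, b) \<in> r \<and> (b, c) \<in> r) \<and> \<not> ((c, b) \<in> r \<and> (b, a) \<in> r))"

end

theory Submission
  imports Defs
begin

text \<open>The pairs \<open>2 * k\<close>, \<open>3 * k\<close> and \<open>3 * k\<close>,
  \<open>5 * k\<close> have ratio below 2, so the precedence rule does not order them directly; the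
  progressions do. As \<open>k\<close> precedes \<open>2 * k\<close>, the progression
  \<open>k\<close>, \<open>2 * k\<close>, \<open>3 * k\<close> forces \<open>3 * k\<close> before
  \<open>2 * k\<close>, which precedes \<open>5 * k\<close>. Then \<open>k\<close>,
  \<open>3 * k\<close>, \<open>5 * k\<close> is placed in increasing order, a contradiction.\<close>

theorem lemma7:
  fixes k :: nat and S :: "nat set"
  assumes "k > 0"
    and "\<forall>s\<in>S. s > 0"
    and "{k, 2 * k, 3 * k, 5 * k} \<subseteq> S"
  shows "\<not> (\<exists>r. arrangement S r \<and> three_AP_free S r \<and>
               (\<forall>u\<in>S. \<forall>w\<in>S. u \<ge> 2 * w \<longrightarrow> (w, u) \<in> r))"
proof
  assume "\<exists>r. arrangement S r \<and> three_AP_free S r \<and>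
               (\<forall>u\<in>S. \<forall>w\<in>S. u \<ge> 2 * w \<longrightarrow> (w, u) \<in> r)"
  then obtain r where arr: "arrangement S r" and free: "three_AP_free S r"
    and before: "\<And>u w. u \<in> S \<Longrightarrow> w \<in> S \<Longrightarrow> u \<ge> 2 * w \<Longrightarrow> (w, u) \<in> r"
    by blast
  have mem: "k \<in> S" "2 * k \<in> S" "3 * k \<in> S" "5 * k \<in> S"
    using assms(3) by auto
  have "trans r" and "total_on S r"
    using arr by (auto simp: arrangement_def strict_linear_order_on_def)
  have "three_AP k (2 * k) (3 * k)" and "three_AP k (3 * k) (5 * k)"
    using \<open>k > 0\<close> by (auto simp: three_AP_def)
  then have not123: "\<not> ((k, 2 * k) \<in> r \<and> (2 * k, 3 * k) \<in> r)"
    and not135: "\<not> ((k, 3 * k) \<in> r \<and> (3 * k, 5 * k) \<in> r)"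
    using free mem unfolding three_AP_free_def by blast+
  have "(k, 2 * k) \<in> r" and "(k, 3 * k) \<in> r" and "(2 * k, 5 * k) \<in> r"
    using before mem by simp_all
  \<comment> \<open>Totality compares only distinct elements.\<close>
  have "3 * k \<noteq> 2 * k"
    using \<open>k > 0\<close> by simp
  then have "(3 * k, 2 * k) \<in> r"
    using \<open>total_on S r\<close> mem not123 \<open>(k, 2 * k) \<in> r\<close>
    unfolding total_on_def by blast
  \<comment> \<open>The element \<open>2 * k\<close> serves as the link: it comes after
    \<open>3 * k\<close> and, since 5 is at least 4, before \<open>5 * k\<close>.\<close>
  then have "(3 * k, 5 * k) \<in> r"
    using \<open>trans r\<close> \<open>(2 * k, 5 * k) \<in> r\<close> by (blast dest: transD)
  with not135 \<open>(k, 3 * k) \<in> r\<close> show False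
    by blast
qed

end
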